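(* For any non-elementary hyperbolic group $\Gamma$, there exists a left-invariant metric on $\Gamma$, quasi-isometric to a word metric, which is not hyperbolic.
   Context: A metric space $(X,d)$ is hyperbolic if for some $\delta\ge0$, $(y|z)_w\ge\min\{(x|y)_w,(x|z)_w\}-\delta$ for all $w,x,y,z\in X$, where $(x|y)_w=\frac12(d(x,w)+d(y,w)-d(x,y))$ (no geodesicity is assumed). A hyperbolic group is a finitely generated group whose locally finite Cayley graphs are hyperbolic; it is non-elementary if it is neither finite nor quasi-isometric to $\mathbb{Z}$. Word metrics are those induced by finite generating sets. Two metrics $d,d'$ on $\Gamma$ are quasi-isometric if there are $\lambda\ge1,c\ge0$ with $\frac1\lambda d-c\le d'\le\lambda d+c$. *)

theory Defs
  imports "HOL-Analysis.Analysis" "HOL-Algebra.Generated_Groups"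
begin

text \<open>
  A metric space is a set \<open>X\<close> with a distance \<open>d\<close> such that \<open>Metric_space X d\<close>; only the values of
  \<open>d\<close> on \<open>X\<close> matter below.
\<close>

definition gromov_product :: "('a \<Rightarrow> 'a \<Rightarrow> real) \<Rightarrow> 'a \<Rightarrow> 'a \<Rightarrow> 'a \<Rightarrow> real" where
  "gromov_product d w x y = (d x w + d y w - d x y) / 2"

definition gromov_hyperbolic :: "'a set \<Rightarrow> ('a \<Rightarrow> 'a \<Rightarrow> real) \<Rightarrow> bool" where
  "gromov_hyperbolic X d \<longleftrightarrow>
     (\<exists>\<delta>\<ge>0. \<forall>w\<in>X. \<forall>x\<in>X. \<forall>y\<in>X. \<forall>z\<in>X.
        gromov_product d w y z \<ge> min (gromov_product d w x y) (gromov_product d w x z) - \<delta>)"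

definition quasi_isometric_metrics ::
    "'a set \<Rightarrow> ('a \<Rightarrow> 'a \<Rightarrow> real) \<Rightarrow> ('a \<Rightarrow> 'a \<Rightarrow> real) \<Rightarrow> bool" where
  "quasi_isometric_metrics X d d' \<longleftrightarrow>
     (\<exists>l\<ge>1. \<exists>c\<ge>0. \<forall>x\<in>X. \<forall>y\<in>X. 1 / l * d x y - c \<le> d' x y \<and> d' x y \<le> l * d x y + c)"

definition quasi_isometric_spaces ::
    "'a set \<Rightarrow> ('a \<Rightarrow> 'a \<Rightarrow> real) \<Rightarrow> 'b set \<Rightarrow> ('b \<Rightarrow> 'b \<Rightarrow> real) \<Rightarrow> bool" where
  "quasi_isometric_spaces X d Y e \<longleftrightarrow>
     (\<exists>f\<in>X \<rightarrow> Y. \<exists>l\<ge>1. \<exists>c\<ge>0.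
        (\<forall>x\<in>X. \<forall>y\<in>X. 1 / l * d x y - c \<le> e (f x) (f y) \<and> e (f x) (f y) \<le> l * d x y + c) \<and>
        (\<forall>y\<in>Y. \<exists>x\<in>X. e (f x) y \<le> c))"

definition generating_set :: "('a, 'b) monoid_scheme \<Rightarrow> 'a set \<Rightarrow> bool" where
  "generating_set G S \<longleftrightarrow> S \<subseteq> carrier G \<and> generate G S = carrier G"

definition word_length :: "('a, 'b) monoid_scheme \<Rightarrow> 'a set \<Rightarrow> 'a \<Rightarrow> nat" where
  "word_length G S g =
     (LEAST n. \<exists>ws. length ws = n \<and> set ws \<subseteq> S \<union> m_inv G ` S \<and>
        foldr (\<otimes>\<^bsub>G\<^esub>) ws \<one>\<^bsub>G\<^esub> = g)"

definition word_metric :: "('a, 'b) monoid_scheme \<Rightarrow> 'a set \<Rightarrow> 'a \<Rightarrow> 'a \<Rightarrow> real" where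
  "word_metric G S g h = real (word_length G S (inv\<^bsub>G\<^esub> g \<otimes>\<^bsub>G\<^esub> h))"

text \<open>
  A Cayley graph is regarded as a metric space by putting the combinatorial path metric on its
  vertex set. Passing to the geometric realization, with edges of length one, changes distances
  by a bounded amount and so only affects the constant of hyperbolicity.
\<close>

definition cayley_edges :: "('a, 'b) monoid_scheme \<Rightarrow> 'a set \<Rightarrow> ('a \<times> 'a) set" where
  "cayley_edges G S =
     {(x, y). x \<in> carrier G \<and> y \<in> carrier G \<and> (\<exists>s\<in>S. y = x \<otimes>\<^bsub>G\<^esub> s \<or> x = y \<otimes>\<^bsub>G\<^esub> s)}"

definition locally_finite_graph :: "('a \<times> 'a) set \<Rightarrow> bool" where
  "locally_finite_graph E \<longleftrightarrow> (\<forall>x. finite (E `` {x}))"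

definition path_metric :: "('a \<times> 'a) set \<Rightarrow> 'a \<Rightarrow> 'a \<Rightarrow> real" where
  "path_metric E x y = real (LEAST n. (x, y) \<in> E ^^ n)"

definition hyperbolic_group :: "('a, 'b) monoid_scheme \<Rightarrow> bool" where
  "hyperbolic_group G \<longleftrightarrow> group G \<and> (\<exists>S. finite S \<and> generating_set G S) \<and>
     (\<forall>S. generating_set G S \<and> locally_finite_graph (cayley_edges G S) \<longrightarrow>
        gromov_hyperbolic (carrier G) (path_metric (cayley_edges G S)))"

text \<open>
  Changing the finite generating set changes the word metric only up to quasi-isometry, so it is
  immaterial whether \<open>S\<close> is quantified existentially or universally here.
\<close>

definition quasi_isometric_to_Z :: "('a, 'b) monoid_scheme \<Rightarrow> bool" where
  "quasi_isometric_to_Z G \<longleftrightarrow>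
     (\<exists>S. finite S \<and> generating_set G S \<and>
        quasi_isometric_spaces (carrier G) (word_metric G S)
          (UNIV :: int set) (\<lambda>m n. real_of_int \<bar>m - n\<bar>))"

definition non_elementary :: "('a, 'b) monoid_scheme \<Rightarrow> bool" where
  "non_elementary G \<longleftrightarrow> infinite (carrier G) \<and> \<not> quasi_isometric_to_Z G"

definition left_invariant :: "('a, 'b) monoid_scheme \<Rightarrow> ('a \<Rightarrow> 'a \<Rightarrow> real) \<Rightarrow> bool" where
  "left_invariant G d \<longleftrightarrow>
     (\<forall>g\<in>carrier G. \<forall>x\<in>carrier G. \<forall>y\<in>carrier G. d (g \<otimes>\<^bsub>G\<^esub> x) (g \<otimes>\<^bsub>G\<^esub> y) = d x y)"

end

theory Submission
  imports Defs
begin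

text \<open>
  Let \<open>\<rho>\<close> be a word metric and put \<open>d = \<rho> + \<surd>\<rho>\<close>. The function \<open>t \<mapsto> t + \<surd>t\<close> is increasing and
  subadditive and vanishes only at \<open>0\<close>, so \<open>d\<close> is again a left-invariant metric; it is quasi-isometric
  to \<open>\<rho>\<close> because \<open>\<rho>\<close> takes integer values, whence \<open>\<rho> \<le> d \<le> 2 \<rho>\<close>.

  It is not hyperbolic, because the strict concavity of the square root is visible along geodesics.
  An infinite group with a finite generating set contains geodesic words of every length. Let
  \<open>p\<^sub>0, p\<^sub>1, p\<^sub>2, p\<^sub>3\<close> lie in this order on a \<open>\<rho>\<close>-geodesic, with consecutive gaps \<open>n\<close>. Up to a
  bounded error, hyperbolicity requires the two largest of the three sums
  \<open>d p\<^sub>0 p\<^sub>1 + d p\<^sub>2 p\<^sub>3\<close>, \<open>d p\<^sub>0 p\<^sub>2 + d p\<^sub>1 p\<^sub>3\<close> and \<open>d p\<^sub>0 p\<^sub>3 + d p\<^sub>1 p\<^sub>2\<close> to coincide. The second one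
  exceeds the first by at least \<open>2 n\<close>. In the last two sums the linear parts are both \<open>4 n\<close>, and so
  the second exceeds the third by \<open>(2 \<surd>2 - \<surd>3 - 1) \<surd>n\<close>. Both differences are unbounded. This is
  \<open>not_hyperbolic_add_sqrt\<close>; the geodesics are supplied by \<open>exists_geodesic\<close>.
\<close>

section \<open>Adding the square root to a metric\<close>

lemma Metric_space_add_sqrt:
  assumes "Metric_space X d"
  shows "Metric_space X (\<lambda>x y. d x y + sqrt (d x y))"
proof -
  interpret Metric_space X d by fact
  show ?thesis
  proof
    show "0 \<le> d x y + sqrt (d x y)" for x y by simp
    show "d x y + sqrt (d x y) = d y x + sqrt (d y x)" for x y by (simp add: commute)
    show "d x y + sqrt (d x y) = 0 \<longleftrightarrow> x = y" if "x \<in> X" "y \<in> X" for x y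
      using that by (simp add: add_nonneg_eq_0_iff)
    show "d x z + sqrt (d x z) \<le> d x y + sqrt (d x y) + (d y z + sqrt (d y z))"
      if "x \<in> X" "y \<in> X" "z \<in> X" for x y z
    proof -
      have t: "d x z \<le> d x y + d y z" using that by (rule triangle)
      then have "sqrt (d x z) \<le> sqrt (d x y + d y z)" by simp
      also have "\<dots> \<le> sqrt (d x y) + sqrt (d y z)"
        by (rule sqrt_add_le_add_sqrt) simp_all
      finally show ?thesis using t by linarith
    qed
  qed
qed

lemma not_hyperbolic_add_sqrt:
  assumes geodesic: "\<And>N::nat. \<exists>p. (\<forall>i\<le>N. p i \<in> X) \<and>
      (\<forall>i j. i \<le> j \<longrightarrow> j \<le> N \<longrightarrow> d (p i) (p j) = real (j - i) \<and> d (p j) (p i) = real (j - i))"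
  shows "\<not> gromov_hyperbolic X (\<lambda>x y. d x y + sqrt (d x y))"
proof
  let ?d = "\<lambda>x y. d x y + sqrt (d x y)"
  assume "gromov_hyperbolic X ?d"
  then obtain \<delta> where "\<delta> \<ge> 0" and hyp: "\<And>w x y z. w \<in> X \<Longrightarrow> x \<in> X \<Longrightarrow> y \<in> X \<Longrightarrow> z \<in> X \<Longrightarrow>
      min (gromov_product ?d w x y) (gromov_product ?d w x z) - \<delta> \<le> gromov_product ?d w y z"
    unfolding gromov_hyperbolic_def by blast
  (* The factor 25 is dictated by the bound 2 sqrt 2 - sqrt 3 - 1 > 2 / 25 below. *)
  obtain m :: nat where m: "real m > 25 * \<delta>" using reals_Archimedean2 by blast
  then have "m > 0" using \<open>\<delta> \<ge> 0\<close> by (cases m) auto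
  (* With a square as the gap, all the square roots are multiples of m. *)
  define n where "n = m * m"
  obtain p where p: "\<And>i. i \<le> 3 * n \<Longrightarrow> p i \<in> X"
    and dist: "\<And>i j. i \<le> j \<Longrightarrow> j \<le> 3 * n \<Longrightarrow>
      d (p i) (p j) = real (j - i) \<and> d (p j) (p i) = real (j - i)"
    using geodesic[of "3 * n"] by blast
  have "min (gromov_product ?d (p 0) (p (2 * n)) (p n)) 
          (gromov_product ?d (p 0) (p (2 * n)) (p (3 * n))) - \<delta>
      \<le> gromov_product ?d (p 0) (p n) (p (3 * n))"
    by (intro hyp p) auto
  moreover have "d (p n) (p 0) = n" "d (p (2 * n)) (p 0) = 2 * n" "d (p (3 * n)) (p 0) = 3 * n"
    "d (p (2 * n)) (p n) = n" "d (p n) (p (3 * n)) = 2 * n" "d (p (2 * n)) (p (3 * n)) = n"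
    using dist[of 0 n] dist[of 0 "2 * n"] dist[of 0 "3 * n"] dist[of n "2 * n"]
      dist[of n "3 * n"] dist[of "2 * n" "3 * n"] by auto
  moreover have "sqrt n = m" "sqrt (2 * n) = sqrt 2 * m" "sqrt (3 * n) = sqrt 3 * m"
    by (simp_all add: n_def real_sqrt_mult)
  ultimately have
    "2 * (sqrt 2 * m) \<le> m + sqrt 3 * m + 2 * \<delta> \<or> n + sqrt 2 * m \<le> m + \<delta>"
    by (auto simp: gromov_product_def min_def field_simps split: if_splits)
  moreover have "141 / 100 < sqrt 2" "sqrt 3 < 174 / 100"
    by (rule real_less_rsqrt real_less_lsqrt; simp add: power2_eq_square)+
  then have "sqrt 2 * m > 141 / 100 * m" "sqrt 3 * m < 174 / 100 * m"
    using \<open>m > 0\<close> by (simp_all only: mult_strict_right_mono of_nat_0_less_iff)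
  moreover have "real n \<ge> m" using \<open>m > 0\<close> by (simp add: n_def)
  ultimately show False using m \<open>\<delta> \<ge> 0\<close> by linarith
qed

section \<open>Words and the word metric\<close>

context group
begin

definition word_over :: "'a set \<Rightarrow> 'a list \<Rightarrow> bool" where
  "word_over S ws \<longleftrightarrow> set ws \<subseteq> S \<union> m_inv G ` S"

abbreviation word_value :: "'a list \<Rightarrow> 'a" where
  "word_value ws \<equiv> foldr (\<otimes>) ws \<one>"

lemma word_over_Nil [simp]: "word_over S []"
  and word_over_append [simp]: "word_over S (us @ vs) \<longleftrightarrow> word_over S us \<and> word_over S vs"
  by (auto simp: word_over_def)

lemma word_over_carrier: "S \<subseteq> carrier G \<Longrightarrow> word_over S ws \<Longrightarrow> set ws \<subseteq> carrier G"
  unfolding word_over_def by auto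

lemma word_value_closed: "set ws \<subseteq> carrier G \<Longrightarrow> word_value ws \<in> carrier G"
  by (induction ws) auto

lemma word_value_append:
  "set us \<subseteq> carrier G \<Longrightarrow> set vs \<subseteq> carrier G \<Longrightarrow>
    word_value (us @ vs) = word_value us \<otimes> word_value vs"
  by (induction us) (auto simp: m_assoc word_value_closed)

lemma word_over_rev_inv:
  assumes "S \<subseteq> carrier G" "word_over S ws"
  shows "word_over S (rev (map (m_inv G) ws))"
proof -
  have "inv x \<in> S \<union> m_inv G ` S" if "x \<in> S \<union> m_inv G ` S" for x
    using that assms(1) by auto
  with assms(2) show ?thesis unfolding word_over_def by fastforce
qed

lemma word_value_rev_inv:
  "set ws \<subseteq> carrier G \<Longrightarrow> word_value (rev (map (m_inv G) ws)) = inv (word_value ws)"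
proof (induction ws)
  case (Cons a ws)
  then have "set (rev (map (m_inv G) ws)) \<subseteq> carrier G" by auto
  then have "word_value (rev (map (m_inv G) ws) @ [inv a])
      = word_value (rev (map (m_inv G) ws)) \<otimes> word_value [inv a]"
    using Cons.prems by (intro word_value_append) auto
  with Cons show ?case
    by (simp add: inv_mult_group word_value_closed del: foldr_append)
qed simp

lemma generate_word: "g \<in> generate G S \<Longrightarrow> S \<subseteq> carrier G \<Longrightarrow> \<exists>ws. word_over S ws \<and> word_value ws = g"
proof (induction g rule: generate.induct)
  case one
  show ?case by (intro exI[of _ "[]"]) simp
next
  case (incl h)
  then show ?case by (intro exI[of _ "[h]"]) (auto simp: word_over_def)
next
  case (inv h)
  then show ?case by (intro exI[of _ "[inv h]"]) (auto simp: word_over_def)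
next
  case (eng h k)
  then obtain us vs where "word_over S us" "word_value us = h" "word_over S vs" "word_value vs = k"
    by blast
  then show ?case using eng.prems
    by (intro exI[of _ "us @ vs"]) (auto simp: word_value_append word_over_carrier simp del: foldr_append)
qed

lemma word_length_le: "word_over S ws \<Longrightarrow> word_length G S (word_value ws) \<le> length ws"
  unfolding word_length_def word_over_def by (rule Least_le) blast

lemma obtain_shortest_word:
  assumes "generating_set G S" "g \<in> carrier G"
  obtains ws where "word_over S ws" "word_value ws = g" "length ws = word_length G S g"
proof -
  have "\<exists>n ws. length ws = n \<and> set ws \<subseteq> S \<union> m_inv G ` S \<and> word_value ws = g"
    using generate_word[of g S] assms by (auto simp: generating_set_def word_over_def)
  from LeastI_ex[OF this] show ?thesis
    using that unfolding word_length_def word_over_def by blast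
qed

lemma word_length_one [simp]: "word_length G S \<one> = 0"
  using word_length_le[of S "[]"] by simp

lemma word_length_eq_0_iff:
  assumes "generating_set G S" "g \<in> carrier G"
  shows "word_length G S g = 0 \<longleftrightarrow> g = \<one>"
  using obtain_shortest_word[OF assms] by (metis foldr_Nil id_apply length_0_conv word_length_one)

lemma word_length_mult_le:
  assumes S: "generating_set G S" and gh: "g \<in> carrier G" "h \<in> carrier G"
  shows "word_length G S (g \<otimes> h) \<le> word_length G S g + word_length G S h"
proof -
  obtain us where us: "word_over S us" "word_value us = g" "length us = word_length G S g"
    using obtain_shortest_word S gh by blast
  obtain vs where vs: "word_over S vs" "word_value vs = h" "length vs = word_length G S h"
    using obtain_shortest_word S gh by blast
  have "word_value (us @ vs) = g \<otimes> h"
    using us vs S word_over_carrier by (subst word_value_append) (auto simp: generating_set_def)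
  then show ?thesis using word_length_le[of S "us @ vs"] us vs by simp
qed

lemma word_length_inv:
  assumes S: "generating_set G S" and g: "g \<in> carrier G"
  shows "word_length G S (inv g) = word_length G S g"
proof -
  have le: "word_length G S (inv h) \<le> word_length G S h" if h: "h \<in> carrier G" for h
  proof -
    obtain ws where ws: "word_over S ws" "word_value ws = h" "length ws = word_length G S h"
      using obtain_shortest_word S h by blast
    have SG: "S \<subseteq> carrier G" using S by (simp add: generating_set_def)
    show ?thesis
      using word_length_le[OF word_over_rev_inv[OF SG ws(1)]]
        word_value_rev_inv[OF word_over_carrier[OF SG ws(1)]] ws by simp
  qed
  show ?thesis using le[of g] le[of "inv g"] g by simp
qed

lemma inv_mult_cancel_left:
  assumes "g \<in> carrier G" "x \<in> carrier G" "y \<in> carrier G"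
  shows "inv (g \<otimes> x) \<otimes> (g \<otimes> y) = inv x \<otimes> y"
  using assms by (metis inv_closed inv_mult_group inv_solve_left m_assoc m_closed)

lemma word_metric_left_invariant: "left_invariant G (word_metric G S)"
  by (simp add: left_invariant_def word_metric_def inv_mult_cancel_left)

lemma word_metric_commute:
  assumes "generating_set G S" "x \<in> carrier G" "y \<in> carrier G"
  shows "word_metric G S x y = word_metric G S y x"
  using word_length_inv[OF assms(1), of "inv x \<otimes> y"] assms
  by (simp add: word_metric_def inv_mult_group)

lemma word_metric_triangle:
  assumes S: "generating_set G S" and xyz: "x \<in> carrier G" "y \<in> carrier G" "z \<in> carrier G"
  shows "word_metric G S x z \<le> word_metric G S x y + word_metric G S y z"
proof -
  have "inv x \<otimes> z = (inv x \<otimes> y) \<otimes> (inv y \<otimes> z)"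
    using xyz by (metis inv_closed inv_solve_left m_assoc m_closed)
  then show ?thesis
    using word_length_mult_le[OF S, of "inv x \<otimes> y" "inv y \<otimes> z"] xyz
    by (simp add: word_metric_def flip: of_nat_add)
qed

text \<open>
  \<open>Metric_space\<close> demands symmetry also outside the carrier, where group inverses and products are
  arbitrary values; setting the distance to \<open>0\<close> there provides it.
\<close>

definition carrier_word_metric :: "'a set \<Rightarrow> 'a \<Rightarrow> 'a \<Rightarrow> real" where
  "carrier_word_metric S x y =
     (if x \<in> carrier G \<and> y \<in> carrier G then word_metric G S x y else 0)"

lemma Metric_space_carrier_word_metric:
  assumes S: "generating_set G S"
  shows "Metric_space (carrier G) (carrier_word_metric S)"
proof
  show "0 \<le> carrier_word_metric S x y" for x y
    by (simp add: carrier_word_metric_def word_metric_def)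
  show "carrier_word_metric S x y = carrier_word_metric S y x" for x y
    using word_metric_commute[OF S] by (auto simp: carrier_word_metric_def)
  show "carrier_word_metric S x y = 0 \<longleftrightarrow> x = y" if "x \<in> carrier G" "y \<in> carrier G" for x y
    using that word_length_eq_0_iff[OF S, of "inv x \<otimes> y"]
    by (metis carrier_word_metric_def inv_closed inv_equality inv_inv m_closed of_nat_eq_0_iff r_inv
        l_inv word_metric_def)
  show "carrier_word_metric S x z \<le> carrier_word_metric S x y + carrier_word_metric S y z"
    if "x \<in> carrier G" "y \<in> carrier G" "z \<in> carrier G" for x y z
    using that word_metric_triangle[OF S] by (simp add: carrier_word_metric_def)
qed

section \<open>Long geodesics\<close>

text \<open>There are only finitely many words of bounded length over a finite alphabet.\<close>

lemma word_length_unbounded: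
  assumes S: "generating_set G S" "finite S" and inf: "infinite (carrier G)"
  shows "\<exists>g\<in>carrier G. N \<le> word_length G S g"
proof (rule ccontr)
  assume short: "\<not> ?thesis"
  let ?W = "{ws. set ws \<subseteq> S \<union> m_inv G ` S \<and> length ws \<le> N}"
  have "carrier G \<subseteq> word_value ` ?W"
  proof
    fix g assume g: "g \<in> carrier G"
    then obtain ws where "word_over S ws" "word_value ws = g" "length ws = word_length G S g"
      using obtain_shortest_word S by blast
    with short g show "g \<in> word_value ` ?W"
      by (auto simp: word_over_def not_le intro!: image_eqI[of _ _ ws] less_imp_le)
  qed
  moreover have "finite ?W" using S by (intro finite_lists_length_le) auto
  ultimately show False using inf finite_surj by blast
qed

text \<open>
  The prefixes of a shortest word form a geodesic: a shorter word for the subword between two of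
  them would shorten the whole word.
\<close>

lemma exists_geodesic:
  assumes S: "generating_set G S" "finite S" and inf: "infinite (carrier G)"
  shows "\<exists>p. (\<forall>i\<le>N. p i \<in> carrier G) \<and>
    (\<forall>i j. i \<le> j \<longrightarrow> j \<le> N \<longrightarrow> word_metric G S (p i) (p j) = real (j - i))"
proof -
  have SG: "S \<subseteq> carrier G" using S by (simp add: generating_set_def)
  obtain g where g: "g \<in> carrier G" "N \<le> word_length G S g"
    using word_length_unbounded[OF S inf] by blast
  obtain ws where ws: "word_over S ws" "word_value ws = g" "length ws = word_length G S g"
    using obtain_shortest_word[OF S(1) g(1)] .
  define p where "p i = word_value (take i ws)" for i
  have over: "word_over S (take i ws)" "word_over S (drop i ws)" for i
    using ws(1) by (auto simp: word_over_def dest: in_set_takeD in_set_dropD)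
  have closed: "p i \<in> carrier G" for i
    unfolding p_def by (intro word_value_closed word_over_carrier[OF SG] over)
  have "word_metric G S (p i) (p j) = real (j - i)" if ij: "i \<le> j" "j \<le> N" for i j
  proof -
    define v where "v = word_value (drop i (take j ws))"
    define r where "r = word_value (drop j ws)"
    have vo: "word_over S (drop i (take j ws))"
      using over(1)[of j] by (auto simp: word_over_def dest: in_set_dropD)
    have v: "v \<in> carrier G" and r: "r \<in> carrier G"
      unfolding v_def r_def by (intro word_value_closed word_over_carrier[OF SG] over vo)+
    have "p j = p i \<otimes> v"
      unfolding p_def v_def
      using word_value_append[OF word_over_carrier[OF SG over(1)[of i]] word_over_carrier[OF SG vo]] ij
      by (metis append_take_drop_id min.absorb1 take_take)
    then have step: "inv (p i) \<otimes> p j = v"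
      using closed[of i] v by (simp flip: m_assoc)
    have g_eq: "g = p j \<otimes> r"
      unfolding p_def r_def
      using word_value_append[OF word_over_carrier[OF SG over(1)[of j]] word_over_carrier[OF SG over(2)[of j]]] ws(2)
      by simp
    have "length (drop i (take j ws)) = j - i" using g ws ij by simp
    then have upper: "word_length G S v \<le> j - i"
      using word_length_le[OF vo] by (simp add: v_def)
    have "word_length G S g \<le> word_length G S (p i) + word_length G S v + word_length G S r"
      unfolding g_eq \<open>p j = p i \<otimes> v\<close>
      using word_length_mult_le[OF S(1), of "p i \<otimes> v" r] word_length_mult_le[OF S(1), of "p i" v]
        closed v r by simp
    moreover have "word_length G S (p i) \<le> i"
      using word_length_le[OF over(1)[of i]] by (simp add: p_def)
    moreover have "word_length G S r \<le> length ws - j"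
      using word_length_le[OF over(2)[of j]] by (simp add: r_def)
    ultimately have "j - i \<le> word_length G S v" using ws g ij by linarith
    with upper show ?thesis by (simp add: word_metric_def step)
  qed
  with closed show ?thesis by blast
qed

end

section \<open>The non-hyperbolic metric\<close>

theorem propositionA11:
  fixes G :: "('a, 'b) monoid_scheme"
  assumes "hyperbolic_group G"
    and "non_elementary G"
  shows "\<exists>d :: 'a \<Rightarrow> 'a \<Rightarrow> real.
           Metric_space (carrier G) d \<and>
           left_invariant G d \<and>
           (\<exists>S. finite S \<and> generating_set G S \<and>
              quasi_isometric_metrics (carrier G) (word_metric G S) d) \<and>
           \<not> gromov_hyperbolic (carrier G) d"
proof -
  interpret group G using assms(1) by (simp add: hyperbolic_group_def)
  obtain S where S: "generating_set G S" "finite S"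
    using assms(1) by (auto simp: hyperbolic_group_def)
  have inf: "infinite (carrier G)" using assms(2) by (simp add: non_elementary_def)
  define d where "d x y = carrier_word_metric S x y + sqrt (carrier_word_metric S x y)" for x y
  have d_carrier: "d x y = word_metric G S x y + sqrt (word_metric G S x y)"
    if "x \<in> carrier G" "y \<in> carrier G" for x y
    using that by (simp add: d_def carrier_word_metric_def)
  have "Metric_space (carrier G) d"
    unfolding d_def by (intro Metric_space_add_sqrt Metric_space_carrier_word_metric S)
  moreover have "left_invariant G d"
    using word_metric_left_invariant[of S] by (simp add: left_invariant_def d_carrier)
  moreover have "quasi_isometric_metrics (carrier G) (word_metric G S) d"
  proof -
    have "sqrt (real k) \<le> real k" for k :: nat
      by (intro real_le_lsqrt) (auto simp: power2_eq_square simp flip: of_nat_mult)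
    then have "sqrt (word_metric G S x y) \<le> word_metric G S x y" for x y
      by (simp add: word_metric_def)
    moreover have "word_metric G S x y \<ge> 0" for x y by (simp add: word_metric_def)
    ultimately show ?thesis
      unfolding quasi_isometric_metrics_def
      by (intro exI[of _ 2] exI[of _ 0] conjI ballI) (simp_all add: d_carrier add_increasing2)
  qed
  moreover have "\<not> gromov_hyperbolic (carrier G) d"
    unfolding d_def
  proof (rule not_hyperbolic_add_sqrt)
    fix N :: nat
    obtain p where p: "\<forall>i\<le>N. p i \<in> carrier G"
      and dist: "\<forall>i j. i \<le> j \<longrightarrow> j \<le> N \<longrightarrow> word_metric G S (p i) (p j) = real (j - i)"
      using exists_geodesic[OF S inf] by blast
    have "carrier_word_metric S (p i) (p j) = real (j - i) \<and>
        carrier_word_metric S (p j) (p i) = real (j - i)" if "i \<le> j" "j \<le> N" for i j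
      using that p dist word_metric_commute[OF S(1), of "p i" "p j"]
      by (simp add: carrier_word_metric_def)
    with p show "\<exists>p. (\<forall>i\<le>N. p i \<in> carrier G) \<and> (\<forall>i j. i \<le> j \<longrightarrow> j \<le> N \<longrightarrow>
        carrier_word_metric S (p i) (p j) = real (j - i) \<and>
        carrier_word_metric S (p j) (p i) = real (j - i))" by blast
  qed
  ultimately show ?thesis using S by blast
qed

end
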